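(* Let $a\in\mathbb R$ and let $\mathcal P\subseteq\mathcal M_1$ be the set of distributions with support in $[a,\infty)$. Any $\mathcal P$-one-sided e-statistic for the mean is bounded above by $$e'(x,r)=1+h(r)\,\frac{x-r}{r-a},\qquad x\ge a,\ r\ge a,$$ for some function $h$ on $[a,\infty)$ with $0\le h\le1$. The upper bound $e'$ is a ($\mathcal P$-)one-sided e-statistic for the mean. Moreover, $e'$ is a ($\mathcal P$-)backtest e-statistic for the mean if and only if $h>0$. The functions $h$ and $r\mapsto(r-a)/h(r)$ are increasing if and only if $e'$ is a monotone ($\mathcal P$-)backtest e-statistic for the mean.
   Context: $\mathcal M_1$ is the set of distributions on $\mathbb R$ with finite mean; $\rho(F)=\int x\,\mathrm dF(x)$ is the mean. "Increasing" and "decreasing" are in the weak sense. The conventions $0/0=1$ and $1/0=\infty$ are in force; for $r=a$ they are applied to the quotient $(x-a)/(r-a)$ in $\frac{x-r}{r-a}=\frac{x-a}{r-a}-1$, with $0\cdot\infty=0$. A measurable $[0,\infty]$-valued function $e(x,r)$ is a $\mathcal P$-one-sided e-statistic for $\rho$ if $\int e(x,r)\,\mathrm dF(x)\le1$ for each $F\in\mathcal P$ and $r\ge\rho(F)$. A $\mathcal P$-one-sided e-statistic is a $\mathcal P$-backtest e-statistic for $\rho$ if $\int e(x,r)\,\mathrm dF(x)>1$ for all $r\in\rho(\mathcal P)$ and all $F\in\mathcal P$ with $\rho(F)>r$. A $\mathcal P$-backtest e-statistic is monotone if, in addition, $r\mapsto e(x,r)$ is decreasing for each $x$ (here for $x\ge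 a$, $r\ge a$).
   Formalization: For the claims that e' is an e-statistic, and a backtest iff h>0, h is taken Borel (else e' is not measurable). In the last equivalence, h>0 is added to the left side (h=0 is a counterexample) and h need be increasing only on (a,∞), as e' barely depends on h(a). *)

theory Defs
  imports "HOL-Probability.Probability"
begin

section \<open>Distributions with finite mean\<close>

definition finite_mean_dists :: "real measure set" where
  "finite_mean_dists = {F. real_distribution F \<and> integrable F (\<lambda>x. x)}"

definition mean :: "real measure \<Rightarrow> real" where
  "mean F = (LINT x|F. x)"

definition dists_supported_from :: "real \<Rightarrow> real measure set" where
  "dists_supported_from a = {F \<in> finite_mean_dists. AE x in F. a \<le> x}"


section \<open>E-statistics\<close>

text \<open>
  Only the values of \<^term>\<open>e x r\<close> for \<^term>\<open>x \<in> X\<close> and \<^term>\<open>r \<in> R\<close> matter: an e-statistic is a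
  function on \<^term>\<open>X \<times> R\<close>, jointly Borel measurable there. The distributions in \<^term>\<open>P\<close> are meant
  to be concentrated on \<^term>\<open>X\<close>, so that the integrals below are integrals over the whole line.
\<close>

definition one_sided_e_statistic ::
  "real set \<Rightarrow> real set \<Rightarrow> real measure set \<Rightarrow> (real measure \<Rightarrow> real)
    \<Rightarrow> (real \<Rightarrow> real \<Rightarrow> ennreal) \<Rightarrow> bool" where
  "one_sided_e_statistic X R P \<rho> e \<longleftrightarrow>
     (\<lambda>(x, r). e x r) \<in> borel_measurable (restrict_space borel (X \<times> R)) \<and>
     (\<forall>F\<in>P. \<forall>r\<in>R. \<rho> F \<le> r \<longrightarrow> (\<integral>\<^sup>+x\<in>X. e x r \<partial>F) \<le> 1)"

definition backtest_e_statistic ::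
  "real set \<Rightarrow> real set \<Rightarrow> real measure set \<Rightarrow> (real measure \<Rightarrow> real)
    \<Rightarrow> (real \<Rightarrow> real \<Rightarrow> ennreal) \<Rightarrow> bool" where
  "backtest_e_statistic X R P \<rho> e \<longleftrightarrow>
     one_sided_e_statistic X R P \<rho> e \<and>
     (\<forall>r\<in>\<rho> ` P. \<forall>F\<in>P. r < \<rho> F \<longrightarrow> 1 < (\<integral>\<^sup>+x\<in>X. e x r \<partial>F))"

definition monotone_backtest_e_statistic ::
  "real set \<Rightarrow> real set \<Rightarrow> real measure set \<Rightarrow> (real measure \<Rightarrow> real)
    \<Rightarrow> (real \<Rightarrow> real \<Rightarrow> ennreal) \<Rightarrow> bool" where
  "monotone_backtest_e_statistic X R P \<rho> e \<longleftrightarrow>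
     backtest_e_statistic X R P \<rho> e \<and> (\<forall>x\<in>X. antimono_on R (\<lambda>r. e x r))"


section \<open>The upper bound\<close>

text \<open>
  Division of nonnegative reals with the conventions \<open>0 / 0 = 1\<close> and \<open>c / 0 = \<infinity>\<close> for \<open>c > 0\<close>.
  Division on \<^typ>\<open>ereal\<close> already satisfies the second one.
\<close>

definition ext_div :: "real \<Rightarrow> real \<Rightarrow> ereal" where
  "ext_div u v = (if u = 0 \<and> v = 0 then 1 else ereal u / ereal v)"

text \<open>
  The quotient \<open>(x - r) / (r - a)\<close> is read as \<open>(x - a) / (r - a) - 1\<close>, so that the conventions make
  sense for \<open>r = a\<close>; on \<^typ>\<open>ereal\<close>, \<open>0 * \<infinity> = 0\<close> and \<open>\<infinity> - 1 = \<infinity>\<close>. The truncation of negative values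
  by \<^const>\<open>e2ennreal\<close> has no effect for \<open>x, r \<ge> a\<close> and \<open>0 \<le> h r \<le> 1\<close>, see
  \<open>mean_e_bound_formula\<close> below.
\<close>

definition mean_e_bound :: "real \<Rightarrow> (real \<Rightarrow> real) \<Rightarrow> real \<Rightarrow> real \<Rightarrow> ennreal" where
  "mean_e_bound a h x r = e2ennreal (1 + ereal (h r) * (ext_div (x - a) (r - a) - 1))"

lemma ext_div_simps:
  "v \<noteq> 0 \<Longrightarrow> ext_div u v = ereal (u / v)"
  "ext_div 0 0 = 1"
  "u > 0 \<Longrightarrow> ext_div u 0 = \<infinity>"
  by (auto simp: ext_div_def)

lemma mean_e_bound_formula:
  assumes "a \<le> x" "a \<le> r" "0 \<le> h r" "h r \<le> 1"
  shows "enn2ereal (mean_e_bound a h x r) = 1 + ereal (h r) * (ext_div (x - a) (r - a) - 1)"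
proof -
  have "0 \<le> 1 + ereal (h r) * (ext_div (x - a) (r - a) - 1)"
  proof (cases "r = a")
    case True
    then show ?thesis
      using assms by (cases "x = a"; cases "h r = 0") (auto simp: ext_div_simps zero_ereal_def[symmetric])
  next
    case False
    with assms have "0 \<le> (x - a) / (r - a)"
      by simp
    then have "0 \<le> h r * ((x - a) / (r - a))"
      using assms by simp
    then have "0 \<le> 1 + h r * ((x - a) / (r - a) - 1)"
      using assms by (simp only: right_diff_distrib)
    then show ?thesis
      using False by (simp add: ext_div_simps one_ereal_def)
  qed
  then show ?thesis
    by (simp add: mean_e_bound_def enn2ereal_e2ennreal)
qed

lemma mean_e_bound_above:
  assumes "a < r"
  shows "mean_e_bound a h x r = ennreal (1 + h r * ((x - r) / (r - a)))"
proof -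
  have "(x - a) / (r - a) - 1 = (x - r) / (r - a)"
    using assms by (simp add: field_simps)
  then show ?thesis
    using assms by (simp add: mean_e_bound_def ext_div_simps one_ereal_def ennreal.abs_eq)
qed

text \<open>
  At \<open>r = a\<close> the bound depends on \<^term>\<open>h a\<close> only through whether \<^term>\<open>h a > 0\<close>. Hence monotonicity of
  the bound in \<^term>\<open>r\<close> cannot constrain \<^term>\<open>h a\<close> relative to the values of \<^term>\<open>h\<close> on \<open>(a, \<infinity>)\<close>.
\<close>

lemma mean_e_bound_at:
  "mean_e_bound a h a a = 1"
  "a < x \<Longrightarrow> 0 < h a \<Longrightarrow> mean_e_bound a h x a = \<infinity>"
  "h a = 0 \<Longrightarrow> mean_e_bound a h x a = 1"
proof -
  have "e2ennreal 1 = 1"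
    by (metis e2ennreal_enn2ereal one_ennreal.rep_eq)
  then show "mean_e_bound a h a a = 1" "h a = 0 \<Longrightarrow> mean_e_bound a h x a = 1"
    by (simp_all add: mean_e_bound_def ext_div_simps zero_ereal_def[symmetric])
  show "mean_e_bound a h x a = \<infinity>" if "a < x" "0 < h a"
    using that by (simp add: mean_e_bound_def ext_div_simps)
qed

end

theory Submission
  imports Defs
begin

text \<open>
  For \<open>r > a\<close>, testing a one-sided e-statistic on two-point distributions with mean \<open>r\<close> shows that
  no line through \<open>(r, 1)\<close> is exceeded by \<open>e(\<cdot>, r)\<close> on both sides of \<open>r\<close>. The supremum \<open>h(r)\<close> of the
  normalised slopes exceeded to the right of \<open>r\<close> then gives a supporting line; Markov's inequality
  gives \<open>h \<le> 1\<close>. This supremum need not be Borel in \<open>r\<close>, but for each rational slope the sets of \<open>r\<close> at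
  which the line is exceeded to the right and to the left are disjoint analytic sets. Lusin's
  theorem separates them by a Borel set, and the separating sets define a Borel function \<open>h\<close>. The
  other claims follow because the bound is affine in \<open>x\<close> with value \<open>1\<close> at \<open>x = r\<close>, with intercept
  \<open>1 - h(r)\<close> at \<open>x = a\<close> and slope \<open>h(r) / (r - a)\<close>.
\<close>

section \<open>Lusin separation of analytic sets\<close>

text \<open>Symmetric in \<open>A\<close> and \<open>B\<close>: the complement of a separating set
  separates them in the other order.\<close>

definition borel_separated :: "'a::topological_space set \<Rightarrow> 'a set \<Rightarrow> bool" where
  "borel_separated A B \<longleftrightarrow> (\<exists>S\<in>sets borel. A \<subseteq> S \<and> B \<inter> S = {})"

text \<open>If \<open>S m n\<close> separates \<open>A m\<close> from \<open>B n\<close>, then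
  \<open>\<Union>m. \<Inter>n. S m n\<close> separates the unions. Used in contrapositive form:
  inseparable unions contain an inseparable pair of pieces.\<close>

lemma borel_separated_UN:
  fixes A B :: "nat \<Rightarrow> 'a::topological_space set"
  assumes "\<And>m n. borel_separated (A m) (B n)"
  shows "borel_separated (\<Union>m. A m) (\<Union>n. B n)"
proof -
  obtain S where S: "\<And>m n. S m n \<in> sets borel" "\<And>m n. A m \<subseteq> S m n" "\<And>m n x. x \<in> B n \<Longrightarrow> x \<notin> S m n"
    using assms unfolding borel_separated_def disjoint_iff by metis
  note S(1)[measurable]
  have "(\<Union>m. \<Inter>n. S m n) \<in> sets borel"
    by measurable
  moreover have "(\<Union>m. A m) \<subseteq> (\<Union>m. \<Inter>n. S m n)"
    by (rule UN_mono) (use S(2) in auto)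
  moreover have "(\<Union>n. B n) \<inter> (\<Union>m. \<Inter>n. S m n) = {}"
    using S(3) by auto
  ultimately show ?thesis
    unfolding borel_separated_def by blast
qed

text \<open>Countably many small closed balls cover the space and so cut \<open>C\<close> and
  \<open>D\<close> into countably many pieces, and some pair of pieces inherits the inseparability.
  Closed balls keep the pieces closed for the nested set theorem.\<close>

lemma not_borel_separated_shrink:
  fixes C D :: "'a::{metric_space, second_countable_topology} set" and g :: "'a \<Rightarrow> 'b::topological_space"
  assumes "closed C" "closed D" "\<not> borel_separated (g ` C) (g ` D)" "0 < \<epsilon>"
  shows "\<exists>C' D'. closed C' \<and> closed D' \<and> \<not> borel_separated (g ` C') (g ` D') \<and> C' \<subseteq> C \<and> D' \<subseteq> D \<and>
    (\<forall>x\<in>C'. \<forall>y\<in>C'. dist x y < \<epsilon>) \<and> (\<forall>x\<in>D'. \<forall>y\<in>D'. dist x y < \<epsilon>)"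
proof -
  obtain X :: "'a set" where X: "countable X" "\<And>U. open U \<Longrightarrow> U \<noteq> {} \<Longrightarrow> \<exists>d\<in>X. d \<in> U"
    by (rule countable_dense_setE) blast
  \<comment> \<open>Radius \<open>\<epsilon> / 3\<close> bounds distances within a ball by
    \<open>2 * \<epsilon> / 3\<close>, hence strictly below \<open>\<epsilon>\<close>.\<close>
  define K where "K n = cball (from_nat_into X n) (\<epsilon> / 3)" for n
  have K: "\<exists>n. x \<in> K n" for x
  proof -
    obtain d where d: "d \<in> X" "d \<in> ball x (\<epsilon> / 3)"
      using X(2)[of "ball x (\<epsilon> / 3)"] \<open>0 < \<epsilon>\<close> by auto
    obtain n where "from_nat_into X n = d"
      using from_nat_into_surj[OF X(1) d(1)] by blast
    with d(2) show ?thesis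
      by (intro exI[of _ n]) (auto simp: K_def dist_commute)
  qed
  have small: "dist x y < \<epsilon>" if "x \<in> K n" "y \<in> K n" for x y n
    using dist_triangle3[of x y "from_nat_into X n"] that \<open>0 < \<epsilon>\<close> by (simp add: K_def)
  have "g ` C = (\<Union>n. g ` (C \<inter> K n))" "g ` D = (\<Union>n. g ` (D \<inter> K n))"
    using K by blast+
  then obtain m n where "\<not> borel_separated (g ` (C \<inter> K m)) (g ` (D \<inter> K n))"
    using borel_separated_UN[of "\<lambda>n. g ` (C \<inter> K n)" "\<lambda>n. g ` (D \<inter> K n)"] assms(3) by metis
  moreover have "closed (C \<inter> K m)" "closed (D \<inter> K n)"
    using assms by (auto simp: K_def)
  ultimately show ?thesis
    using small[of _ m] small[of _ n] by (intro exI[of _ "C \<inter> K m"] exI[of _ "D \<inter> K n"] conjI) (assumption | blast)+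
qed

text \<open>Inseparable images would allow shrinking \<open>C\<close> and \<open>D\<close> forever.
  By completeness the pieces close in on points \<open>x\<close> of \<open>C\<close> and
  \<open>y\<close> of \<open>D\<close>, and \<open>g x \<noteq> g y\<close>. Disjoint neighbourhoods
  of \<open>g x\<close> and \<open>g y\<close> then contain the images of late pieces, so an open
  set separates them after all.\<close>

lemma borel_separated_continuous_image:
  fixes C D :: "'a::{complete_space, second_countable_topology} set" and g :: "'a \<Rightarrow> 'b::t2_space"
  assumes "closed C" "closed D" "continuous_on UNIV g" "g ` C \<inter> g ` D = {}"
  shows "borel_separated (g ` C) (g ` D)"
proof (rule ccontr)
  assume not_sep: "\<not> borel_separated (g ` C) (g ` D)"
  \<comment> \<open>Stage 0 carries no diameter bound, since the initial sets \<open>C\<close> and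
    \<open>D\<close> may be unbounded.\<close>
  define P where "P k p \<longleftrightarrow> closed (fst p) \<and> closed (snd p) \<and>
    \<not> borel_separated (g ` fst p) (g ` snd p) \<and> fst p \<subseteq> C \<and> snd p \<subseteq> D \<and>
    (0 < k \<longrightarrow> (\<forall>x\<in>fst p. \<forall>y\<in>fst p. dist x y < 1 / real k) \<and>
                (\<forall>x\<in>snd p. \<forall>y\<in>snd p. dist x y < 1 / real k))" for k :: nat and p
  have "\<exists>f. \<forall>k. P k (f k) \<and> (fst (f (Suc k)) \<subseteq> fst (f k) \<and> snd (f (Suc k)) \<subseteq> snd (f k))"
  proof (rule dependent_nat_choice)
    have "P 0 (C, D)"
      using assms(1,2) not_sep by (simp add: P_def)
    then show "\<exists>p. P 0 p" ..
  next
    fix p k assume p: "P k p"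
    have "0 < 1 / real (Suc k)"
      by simp
    moreover have "closed (fst p)" "closed (snd p)" "\<not> borel_separated (g ` fst p) (g ` snd p)"
      using p by (simp_all add: P_def)
    ultimately obtain C' D' where "closed C'" "closed D'" "\<not> borel_separated (g ` C') (g ` D')"
      "C' \<subseteq> fst p" "D' \<subseteq> snd p" "\<forall>x\<in>C'. \<forall>y\<in>C'. dist x y < 1 / real (Suc k)"
      "\<forall>x\<in>D'. \<forall>y\<in>D'. dist x y < 1 / real (Suc k)"
      using not_borel_separated_shrink by metis
    moreover from this p have "P (Suc k) (C', D')"
      by (simp add: P_def order_trans[of C'] order_trans[of D'])
    ultimately show "\<exists>p'. P (Suc k) p' \<and> (fst p' \<subseteq> fst p \<and> snd p' \<subseteq> snd p)"
      by (intro exI[of _ "(C', D')"]) simp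
  qed
  then obtain f where f: "\<And>k. P k (f k)" 
      "\<And>k. fst (f (Suc k)) \<subseteq> fst (f k)" "\<And>k. snd (f (Suc k)) \<subseteq> snd (f k)"
    by blast
  have small: "\<exists>k. \<forall>x\<in>S k. \<forall>y\<in>S k. dist x y < \<epsilon>"
    if \<epsilon>: "0 < \<epsilon>" and S: "\<And>k. 0 < k \<Longrightarrow> \<forall>x\<in>S k. \<forall>y\<in>S k. dist x y < 1 / real k" for S :: "nat \<Rightarrow> 'a set" and \<epsilon>
  proof -
    obtain n where n: "1 / real (Suc n) < \<epsilon>"
      using nat_approx_posE[OF \<epsilon>] .
    have "dist x y < \<epsilon>" if "x \<in> S (Suc n)" "y \<in> S (Suc n)" for x y
      using less_trans[OF _ n] S[of "Suc n"] that by blast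
    then show ?thesis
      by blast
  qed
  have smallC: "\<exists>k. \<forall>x\<in>fst (f k). \<forall>y\<in>fst (f k). dist x y < \<epsilon>" if "0 < \<epsilon>" for \<epsilon>
    using small[of \<epsilon> "\<lambda>k. fst (f k)"] that f(1) by (simp add: P_def)
  have smallD: "\<exists>k. \<forall>x\<in>snd (f k). \<forall>y\<in>snd (f k). dist x y < \<epsilon>" if "0 < \<epsilon>" for \<epsilon>
    using small[of \<epsilon> "\<lambda>k. snd (f k)"] that f(1) by (simp add: P_def)
  have decC: "fst (f n) \<subseteq> fst (f m)" if "m \<le> n" for m n
    using lift_Suc_antimono_le[of "\<lambda>k. fst (f k)"] f(2) that by blast
  have decD: "snd (f n) \<subseteq> snd (f m)" if "m \<le> n" for m n
    using lift_Suc_antimono_le[of "\<lambda>k. snd (f k)"] f(3) that by blast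
  \<comment> \<open>An empty image is separated from anything by \<open>{}\<close> or
    \<open>UNIV\<close>; the nested set theorem needs nonempty pieces.\<close>
  have ne: "fst (f k) \<noteq> {}" "snd (f k) \<noteq> {}" for k
  proof -
    have "\<not> borel_separated (g ` fst (f k)) (g ` snd (f k))"
      using f(1)[of k] by (simp add: P_def)
    moreover have "borel_separated {} (g ` B)" "borel_separated (g ` B) {}" for B
      unfolding borel_separated_def by (rule bexI[of _ "{}"], simp_all) (rule bexI[of _ UNIV], simp_all)
    ultimately show "fst (f k) \<noteq> {}" "snd (f k) \<noteq> {}"
      by (metis image_empty)+
  qed
  obtain x where x: "\<And>k. x \<in> fst (f k)"
    using decreasing_closed_nest[of "\<lambda>k. fst (f k)"] f(1) ne decC smallC by (auto simp: P_def)
  obtain y where y: "\<And>k. y \<in> snd (f k)"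
    using decreasing_closed_nest[of "\<lambda>k. snd (f k)"] f(1) ne decD smallD by (auto simp: P_def)
  have "fst (f 0) \<subseteq> C" "snd (f 0) \<subseteq> D"
    using f(1)[of 0] by (simp_all add: P_def)
  then have "x \<in> C" "y \<in> D"
    using x[of 0] y[of 0] by (simp_all add: subset_iff)
  then have "g x \<in> g ` C" "g y \<in> g ` D"
    by (simp_all only: imageI)
  then have "g x \<noteq> g y"
    using assms(4) by (metis disjoint_iff)
  then obtain U V where UV: "open U" "open V" "g x \<in> U" "g y \<in> V" "U \<inter> V = {}"
    using hausdorff[of "g x" "g y"] by metis
  have "open (g -` U)" "open (g -` V)"
    using UV assms(3) by (auto intro: open_vimage)
  then obtain \<epsilon> \<delta> where \<epsilon>: "0 < \<epsilon>" "ball x \<epsilon> \<subseteq> g -` U" and \<delta>: "0 < \<delta>" "ball y \<delta> \<subseteq> g -` V"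
    using UV by (metis openE vimageI)
  obtain m where m: "\<forall>x\<in>fst (f m). \<forall>y\<in>fst (f m). dist x y < \<epsilon>"
    using smallC \<epsilon> by blast
  obtain n where n: "\<forall>x\<in>snd (f n). \<forall>y\<in>snd (f n). dist x y < \<delta>"
    using smallD \<delta> by blast
  define k where "k = max m n"
  have "fst (f k) \<subseteq> ball x \<epsilon>" "snd (f k) \<subseteq> ball y \<delta>"
    using m n x y decC[of m k] decD[of n k] by (auto simp: k_def)
  then have "g ` fst (f k) \<subseteq> U" "g ` snd (f k) \<inter> U = {}"
    using \<epsilon>(2) \<delta>(2) UV(5) by blast+
  then have "borel_separated (g ` fst (f k)) (g ` snd (f k))"
    using UV(1) unfolding borel_separated_def by (intro bexI[of _ U]) auto
  then show False
    using f(1)[of k] by (simp add: P_def)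
qed

text \<open>Sequences of reals serve in place of the Baire space.\<close>

definition analytic_set :: "'a::topological_space set \<Rightarrow> bool" where
  "analytic_set A \<longleftrightarrow> (\<exists>C :: ('a \<times> (nat \<Rightarrow> real)) set. closed C \<and> A = fst ` C)"

section \<open>Closure properties of analytic sets\<close>

lemma analytic_set_closed:
  assumes "closed A"
  shows "analytic_set A"
  unfolding analytic_set_def using assms
  by (intro exI[of _ "A \<times> UNIV"]) (auto intro: closed_Times)

lemma continuous_on_snd_coordinate:
  fixes S :: "('a::topological_space \<times> ('i \<Rightarrow> 'b::topological_space)) set"
  shows "continuous_on S (\<lambda>p. snd p i)"
  by (rule continuous_on_product_then_coordinatewise) (intro continuous_intros)

text \<open>Coordinate 0 of the auxiliary sequence names the index \<open>n\<close> of a set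
  containing the point; the remaining coordinates are a witness for membership in
  \<open>A n\<close>.\<close>

lemma analytic_set_UN:
  fixes A :: "nat \<Rightarrow> 'a::topological_space set"
  assumes "\<And>n. analytic_set (A n)"
  shows "analytic_set (\<Union>n. A n)"
proof -
  obtain C :: "nat \<Rightarrow> ('a \<times> (nat \<Rightarrow> real)) set" where C: "\<And>n. closed (C n)" "\<And>n. A n = fst ` C n"
    using assms unfolding analytic_set_def by metis
  define tail :: "'a \<times> (nat \<Rightarrow> real) \<Rightarrow> 'a \<times> (nat \<Rightarrow> real)" where "tail p = (fst p, \<lambda>i. snd p (Suc i))" for p
  define head :: "'a \<times> (nat \<Rightarrow> real) \<Rightarrow> real" where "head p = snd p 0" for p
  have cont: "continuous_on UNIV tail" "continuous_on UNIV head"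
    unfolding tail_def head_def by (intro continuous_intros continuous_on_snd_coordinate)+
  \<comment> \<open>"The head is a natural number \<open>n\<close> and the tail lies in
    \<open>C n\<close>", written as an intersection of closed conditions: for every
    \<open>n\<close>, either the head is a natural other than \<open>n\<close> or the tail lies in
    \<open>C n\<close>.\<close>
  define D where "D = head -` \<nat> \<inter> (\<Inter>n. head -` (\<nat> - {real n}) \<union> tail -` C n)"
  have "closed (\<nat> - {real n})" for n
  proof -
    have "\<nat> - {real n} = real ` (- {n})"
      by (auto simp: Nats_def)
    then show ?thesis
      by (metis closed_of_nat_image)
  qed
  then have "closed D"
    unfolding D_def using cont C(1) closed_Nats
    by (intro closed_Int closed_INT closed_Un ballI closed_vimage) auto
  moreover have "(\<Union>n. A n) = fst ` D"
  proof (intro equalityI subsetI)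
    fix x assume "x \<in> (\<Union>n. A n)"
    then obtain n s where s: "(x, s) \<in> C n"
      using C(2) by auto
    define t where "t = case_nat (real n) s"
    have "(x, t) \<in> D"
      using s by (auto simp: D_def t_def head_def tail_def)
    then show "x \<in> fst ` D"
      by force
  next
    fix x assume "x \<in> fst ` D"
    then obtain s where s: "(x, s) \<in> D"
      by auto
    then obtain n where "s 0 = real n"
      by (auto simp: D_def head_def elim: Nats_cases)
    with s have "tail (x, s) \<in> C n"
      by (auto simp: D_def head_def)
    then show "x \<in> (\<Union>n. A n)"
      using C(2) by (force simp: tail_def)
  qed
  ultimately show ?thesis
    unfolding analytic_set_def by blast
qed

text \<open>The pairing function splits one sequence into countably many rows, and row
  \<open>n\<close> is a witness for membership in \<open>A n\<close>.\<close>

lemma analytic_set_INT: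
  fixes A :: "nat \<Rightarrow> 'a::topological_space set"
  assumes "\<And>n. analytic_set (A n)"
  shows "analytic_set (\<Inter>n. A n)"
proof -
  obtain C :: "nat \<Rightarrow> ('a \<times> (nat \<Rightarrow> real)) set" where C: "\<And>n. closed (C n)" "\<And>n. A n = fst ` C n"
    using assms unfolding analytic_set_def by metis
  define row :: "nat \<Rightarrow> 'a \<times> (nat \<Rightarrow> real) \<Rightarrow> 'a \<times> (nat \<Rightarrow> real)"
    where "row n p = (fst p, \<lambda>i. snd p (prod_encode (n, i)))" for n p
  have cont: "continuous_on UNIV (row n)" for n
    unfolding row_def by (intro continuous_intros continuous_on_snd_coordinate)
  define D where "D = (\<Inter>n. row n -` C n)"
  have "closed D"
    unfolding D_def using cont C(1) by (intro closed_INT ballI closed_vimage) auto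
  moreover have "(\<Inter>n. A n) = fst ` D"
  proof (intro equalityI subsetI)
    fix x assume "x \<in> (\<Inter>n. A n)"
    then have "\<forall>n. \<exists>s. (x, s) \<in> C n"
      using C(2) by fastforce
    then obtain s where s: "\<And>n. (x, s n) \<in> C n"
      by metis
    have "(x, \<lambda>k. case prod_decode k of (n, i) \<Rightarrow> s n i) \<in> D"
      using s by (simp add: D_def row_def)
    then show "x \<in> fst ` D"
      by force
  next
    fix x assume "x \<in> fst ` D"
    then show "x \<in> (\<Inter>n. A n)"
      using C(2) by (force simp: D_def row_def)
  qed
  ultimately show ?thesis
    unfolding analytic_set_def by blast
qed

lemma analytic_set_open:
  fixes A :: "'a::metric_space set"
  assumes "open A"
  shows "analytic_set A"
proof -
  have "fsigma_in euclidean A"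
    using assms by (simp add: open_imp_fsigma_in metrizable_space_euclidean)
  then obtain C :: "nat \<Rightarrow> 'a set" where C: "\<And>n. closed (C n)" "(\<Union>n. C n) = A"
    by (auto simp: fsigma_in_ascending)
  have "analytic_set (\<Union>n. C n)"
    by (intro analytic_set_UN analytic_set_closed C(1))
  then show ?thesis
    by (simp add: C(2))
qed

text \<open>Analyticity need not pass to complements, so the induction over the sigma-algebra
  carries a set and its complement together.\<close>

lemma analytic_set_borel:
  fixes A :: "'a::metric_space set"
  assumes "A \<in> sets borel"
  shows "analytic_set A"
proof -
  have "A \<in> sigma_sets UNIV {U. open U}"
    using assms by (simp add: borel_def)
  then have "analytic_set A \<and> analytic_set (- A)"
  proof induction
    case (Basic U)
    then show ?case
      using analytic_set_open[of U] analytic_set_closed[of "- U"] by (simp add: closed_Compl)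
  next
    case Empty
    show ?case
      using analytic_set_closed[of "{}"] analytic_set_closed[of UNIV] by simp
  next
    case (Compl A)
    then show ?case
      by (simp add: Compl_eq_Diff_UNIV[symmetric])
  next
    case (Union A)
    then have "analytic_set (\<Inter>n. - A n)" "analytic_set (\<Union>n. A n)"
      by (simp_all add: analytic_set_INT analytic_set_UN)
    then show ?case
      by simp
  qed
  then show ?thesis ..
qed

text \<open>Borel sets in the product are projections of closed sets, so their own projections are
  images of closed sets under the continuous map \<open>fst \<circ> fst\<close>, to which the
  separation theorem applies.\<close>

lemma borel_separated_fst_image:
  fixes E E' :: " ('a::{complete_space, second_countable_topology} \<times>
    'b::{complete_space, second_countable_topology}) set"
  assumes "E \<in> sets borel" "E' \<in> sets borel" "fst ` E \<inter> fst ` E' = {}"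
  shows "borel_separated (fst ` E) (fst ` E')"
proof -
  obtain C D :: "(('a \<times> 'b) \<times> (nat \<Rightarrow> real)) set"
    where "closed C" "E = fst ` C" "closed D" "E' = fst ` D"
    using analytic_set_borel[OF assms(1)] analytic_set_borel[OF assms(2)]
    unfolding analytic_set_def by blast
  moreover have "continuous_on UNIV (\<lambda>p :: ('a \<times> 'b) \<times> (nat \<Rightarrow> real). fst (fst p))"
    by (intro continuous_intros)
  ultimately have "borel_separated ((\<lambda>p. fst (fst p)) ` C) ((\<lambda>p. fst (fst p)) ` D)"
    using assms(3) by (intro borel_separated_continuous_image) (simp_all add: image_image)
  then show ?thesis
    using \<open>E = fst ` C\<close> \<open>E' = fst ` D\<close> by (simp add: image_image)
qed


section \<open>The upper bound for one-sided e-statistics\<close>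

definition two_point_dist :: "real \<Rightarrow> real \<Rightarrow> real \<Rightarrow> real measure" where
  "two_point_dist p x y = distr (measure_pmf (bernoulli_pmf p)) borel (\<lambda>b. if b then x else y)"

lemma two_point_dist_supported:
  assumes "a \<le> x" "a \<le> y"
  shows "two_point_dist p x y \<in> dists_supported_from a"
proof -
  have "real_distribution (two_point_dist p x y)"
    unfolding two_point_dist_def by (intro prob_space.real_distribution_distr prob_space_measure_pmf) simp
  moreover have "integrable (two_point_dist p x y) (\<lambda>x. x)"
    unfolding two_point_dist_def by (subst integrable_distr_eq) (auto intro: integrable_measure_pmf_finite)
  moreover have "AE z in two_point_dist p x y. a \<le> z"
    unfolding two_point_dist_def by (subst AE_distr_iff) (use assms in auto)
  ultimately show ?thesis
    by (simp add: dists_supported_from_def finite_mean_dists_def)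
qed

lemma mean_two_point_dist:
  assumes "0 \<le> p" "p \<le> 1"
  shows "mean (two_point_dist p x y) = p * x + (1 - p) * y"
  unfolding mean_def two_point_dist_def using assms by (subst integral_distr) auto

lemma nn_integral_two_point_dist:
  assumes "0 \<le> p" "p \<le> 1" "f \<in> borel_measurable borel"
  shows "(\<integral>\<^sup>+z. f z \<partial>two_point_dist p x y) = f x * ennreal p + f y * ennreal (1 - p)"
  unfolding two_point_dist_def using assms by (subst nn_integral_distr) auto

lemma Times_atLeast_borel: "{a..} \<times> {b..} \<in> sets (borel :: (real \<times> real) measure)"
  by (intro borel_closed closed_Times closed_atLeast)

lemma one_sided_e_statistic_measurable:
  assumes "one_sided_e_statistic {a..} {a..} P \<rho> e"
  shows "(\<lambda>p. e (fst p) (snd p) * indicator ({a..} \<times> {a..}) p) \<in> borel_measurable borel"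
  using assms Times_atLeast_borel[of a a]
  by (simp add: one_sided_e_statistic_def borel_measurable_restrict_space_iff_ennreal split_beta)

lemma one_sided_e_statistic_section_measurable:
  assumes "one_sided_e_statistic {a..} {a..} P \<rho> e" "a \<le> r"
  shows "(\<lambda>x. e x r * indicator {a..} x) \<in> borel_measurable borel"
proof -
  have "(\<lambda>x. (x, r)) \<in> borel_measurable borel"
    by (intro borel_measurable_continuous_onI continuous_intros)
  from measurable_compose[OF this one_sided_e_statistic_measurable[OF assms(1)]]
  show ?thesis
    using assms(2) by (simp add: indicator_times)
qed

text \<open>Real lower bounds \<open>c\<close> and \<open>d\<close> stand in for the values of
  \<open>e\<close>, which may be infinite, so that later arguments take place in the reals.\<close>

lemma one_sided_e_statistic_two_point:
  assumes e: "one_sided_e_statistic {a..} {a..} (dists_supported_from a) mean e"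
    and p: "0 \<le> p" "p \<le> 1" and xy: "a \<le> x" "a \<le> y" and r: "a \<le> r" "p * x + (1 - p) * y \<le> r"
    and cd: "0 \<le> c" "ennreal c \<le> e x r" "0 \<le> d" "ennreal d \<le> e y r"
  shows "p * c + (1 - p) * d \<le> 1"
proof -
  have "(\<integral>\<^sup>+z\<in>{a..}. e z r \<partial>two_point_dist p x y) \<le> 1"
    using e two_point_dist_supported[OF xy] r mean_two_point_dist[OF p]
    by (simp add: one_sided_e_statistic_def)
  then have "e x r * ennreal p + e y r * ennreal (1 - p) \<le> 1"
    using one_sided_e_statistic_section_measurable[OF e r(1)] p xy
    by (simp add: nn_integral_two_point_dist)
  moreover have "ennreal c * ennreal p + ennreal d * ennreal (1 - p)
      \<le> e x r * ennreal p + e y r * ennreal (1 - p)"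
    using cd by (intro add_mono mult_right_mono) auto
  ultimately have "ennreal c * ennreal p + ennreal d * ennreal (1 - p) \<le> 1"
    by (rule order_trans[rotated])
  then have "ennreal (c * p + d * (1 - p)) \<le> ennreal 1"
    using cd p by (simp add: ennreal_mult)
  then show ?thesis
    by (simp add: mult.commute)
qed

section \<open>Pointwise constraints on a one-sided e-statistic\<close>

lemma ennreal_less_imp_ex_real:
  assumes "ennreal c < u"
  shows "\<exists>c'>c. 0 < c' \<and> ennreal c' \<le> u"
proof (cases u)
  case (real v)
  with assms have less: "ennreal c < ennreal v"
    by simp
  then have "\<not> v \<le> c"
    using ennreal_leI[of v c] by (metis not_le)
  moreover have "v \<noteq> 0"
    using less by auto
  ultimately have "c < v" "0 < v"
    using real by simp_all
  with real show ?thesis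
    by (intro exI[of _ v]) simp
next
  case top
  then show ?thesis
    by (intro exI[of _ "max 0 c + 1"]) auto
qed

text \<open>Tested on the point mass at \<open>x\<close>, whose mean is at most
  \<open>r\<close>.\<close>

lemma one_sided_e_statistic_le_1:
  assumes e: "one_sided_e_statistic {a..} {a..} (dists_supported_from a) mean e"
    and "a \<le> x" "x \<le> r"
  shows "e x r \<le> 1"
proof (rule ccontr)
  assume "\<not> e x r \<le> 1"
  then obtain c where "1 < c" "ennreal c \<le> e x r"
    using ennreal_less_imp_ex_real[of 1 "e x r"] by (auto simp: not_le)
  then show False
    using one_sided_e_statistic_two_point[OF e, of 1 x x r c 0] assms by simp
qed

text \<open>Tested on the extremal case of Markov's inequality: mass on \<open>a\<close> and
  \<open>x\<close> only, weighted to have mean \<open>r\<close>, with the value at \<open>a\<close>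
  bounded below by 0.\<close>

lemma one_sided_e_statistic_le_Markov:
  assumes e: "one_sided_e_statistic {a..} {a..} (dists_supported_from a) mean e"
    and "a < r" "r < x"
  shows "e x r \<le> ennreal ((x - a) / (r - a))"
proof (rule ccontr)
  assume "\<not> e x r \<le> ennreal ((x - a) / (r - a))"
  then obtain c where c: "(x - a) / (r - a) < c" "0 \<le> c" "ennreal c \<le> e x r"
    using ennreal_less_imp_ex_real[of "(x - a) / (r - a)" "e x r"] by (auto simp: not_le)
  define p where "p = (r - a) / (x - a)"
  have p: "0 \<le> p" "p \<le> 1"
    using assms by (auto simp: p_def)
  have "p * (x - a) = r - a"
    using assms by (simp add: p_def)
  then have "p * x + (1 - p) * a = r"
    by (simp add: algebra_simps)
  then have "p * c \<le> 1"
    using one_sided_e_statistic_two_point[OF e p, of x a r c 0] assms c by simp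
  then show False
    using c(1) assms by (simp add: p_def field_simps)
qed

text \<open>A line with value 1 at \<open>r\<close> averages to 1 under the two-point distribution
  on \<open>x\<close> and \<open>y\<close> with mean \<open>r\<close>. Exceeding the line at both
  points would push the expectation of \<open>e\<close> above 1.\<close>

lemma one_sided_e_statistic_no_crossing:
  assumes e: "one_sided_e_statistic {a..} {a..} (dists_supported_from a) mean e"
    and "a < r" "r < x" "a \<le> y" "y < r" "0 \<le> q" "q \<le> 1"
    and "ennreal (1 + q * ((x - r) / (r - a))) < e x r"
  shows "e y r \<le> ennreal (1 + q * ((y - r) / (r - a)))"
proof (rule ccontr)
  assume "\<not> e y r \<le> ennreal (1 + q * ((y - r) / (r - a)))"
  then obtain d where d: "1 + q * ((y - r) / (r - a)) < d" "0 \<le> d" "ennreal d \<le> e y r"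
    using ennreal_less_imp_ex_real[of "1 + q * ((y - r) / (r - a))" "e y r"] by (auto simp: not_le)
  obtain c where c: "1 + q * ((x - r) / (r - a)) < c" "0 \<le> c" "ennreal c \<le> e x r"
    using ennreal_less_imp_ex_real[OF assms(8)] by auto
  define p where "p = (r - y) / (x - y)"
  have p: "0 < p" "p < 1"
    using assms by (auto simp: p_def)
  have "p * (x - y) = r - y"
    using assms by (simp add: p_def)
  then have mean: "p * x + (1 - p) * y = r"
    by (simp add: algebra_simps)
  have "p * (1 + q * ((x - r) / (r - a))) + (1 - p) * (1 + q * ((y - r) / (r - a)))
      = 1 + q * ((p * x + (1 - p) * y - r) / (r - a))"
    using \<open>a < r\<close> by (simp add: divide_simps) (simp add: algebra_simps)
  also have "\<dots> = 1"
    by (simp add: mean)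
  finally have "1 = p * (1 + q * ((x - r) / (r - a))) + (1 - p) * (1 + q * ((y - r) / (r - a)))"
    by simp
  also have "\<dots> < p * c + (1 - p) * d"
    using c d p by (intro add_strict_mono mult_strict_left_mono) auto
  also have "\<dots> \<le> 1"
    using one_sided_e_statistic_two_point[OF e, of p x y r c d] assms c d p mean by simp
  finally show False
    by simp
qed

text \<open>
  The two sets of parameters \<^term>\<open>r\<close> at which the line of slope \<^term>\<open>q\<close> fails are projections of Borel
  sets, hence only analytic; a Borel choice of \<^term>\<open>h\<close> needs a Borel set separating them.
\<close>

lemma exists_Borel_slope:
  assumes e: "one_sided_e_statistic {a..} {a..} (dists_supported_from a) mean e"
    and q: "0 \<le> q" "q \<le> 1"
  shows "\<exists>S\<in>sets borel.
    (\<forall>r x. a < r \<longrightarrow> r < x \<longrightarrow> ennreal (1 + q * ((x - r) / (r - a))) < e x r \<longrightarrow> r \<in> S) \<and>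
    (\<forall>r x. a < r \<longrightarrow> a \<le> x \<longrightarrow> x < r \<longrightarrow> ennreal (1 + q * ((x - r) / (r - a))) < e x r \<longrightarrow> r \<notin> S)"
proof -
  \<comment> \<open>The coordinates are swapped so that \<open>fst\<close> projects onto the
    parameter \<open>r\<close>; the indicator extends \<open>e\<close> by 0 to a Borel function on
    the plane.\<close>
  define f :: "real \<times> real \<Rightarrow> ennreal"
    where "f p = e (snd p) (fst p) * indicator ({a..} \<times> {a..}) (snd p, fst p)" for p
  have [measurable]: "f \<in> borel_measurable borel"
  proof -
    have "(\<lambda>p :: real \<times> real. (snd p, fst p)) \<in> borel_measurable borel"
      by (intro borel_measurable_continuous_onI continuous_intros)
    from measurable_compose[OF this one_sided_e_statistic_measurable[OF e]] show ?thesis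
      by (simp add: f_def[abs_def])
  qed
  have [measurable]: "fst \<in> borel_measurable (borel :: (real \<times> real) measure)"
    "snd \<in> borel_measurable (borel :: (real \<times> real) measure)"
    by (auto intro!: borel_measurable_continuous_onI continuous_intros)
  define l where "l p = ennreal (1 + q * ((snd p - fst p) / (fst p - a)))" for p :: "real \<times> real"
  have [measurable]: "l \<in> borel_measurable borel"
    unfolding l_def by measurable
  define E where "E = {p. a < fst p \<and> fst p < snd p \<and> l p < f p}"
  define E' where "E' = {p. a < fst p \<and> a \<le> snd p \<and> snd p < fst p \<and> l p < f p}"
  have "E \<in> sets borel" "E' \<in> sets borel"
    unfolding E_def E'_def by measurable
  moreover have "fst ` E \<inter> fst ` E' = {}"
  proof -
    have False if "(r, x) \<in> E" "(r, y) \<in> E'" for r x y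
      using one_sided_e_statistic_no_crossing[OF e, of r x y q] q that
      by (auto simp: E_def E'_def l_def f_def)
    then show ?thesis
      by fastforce
  qed
  ultimately have "borel_separated (fst ` E) (fst ` E')"
    by (rule borel_separated_fst_image)
  then obtain S where S: "S \<in> sets borel" "fst ` E \<subseteq> S" "fst ` E' \<inter> S = {}"
    unfolding borel_separated_def by metis
  have "r \<in> S" if "a < r" "r < x" "ennreal (1 + q * ((x - r) / (r - a))) < e x r" for r x
  proof -
    have "(r, x) \<in> E"
      using that by (simp add: E_def l_def f_def)
    then show ?thesis
      using S(2) by force
  qed
  moreover have "r \<notin> S"
    if "a < r" "a \<le> x" "x < r" "ennreal (1 + q * ((x - r) / (r - a))) < e x r" for r x
  proof -
    have "(r, x) \<in> E'"
      using that by (simp add: E'_def l_def f_def)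
    then have "r \<in> fst ` E'"
      by force
    then show ?thesis
      using S(3) by (metis disjoint_iff)
  qed
  ultimately show ?thesis
    using S(1) by blast
qed


text \<open>\<open>h r\<close> is the supremum of the rational slopes \<open>q\<close> with
  \<open>r \<in> S q\<close>. Where the line of slope \<open>q\<close> fails on neither side,
  membership in \<open>S q\<close> is arbitrary; only slopes failing on a known side enter the
  estimates.\<close>

lemma one_sided_e_statistic_le_mean_e_bound:
  assumes e: "one_sided_e_statistic {a..} {a..} (dists_supported_from a) mean e"
  shows "\<exists>h. h \<in> borel_measurable (restrict_space borel {a..}) \<and> (\<forall>r\<ge>a. 0 \<le> h r \<and> h r \<le> 1) \<and>
    (\<forall>x\<ge>a. \<forall>r\<ge>a. e x r \<le> mean_e_bound a h x r)"
proof -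
  define Q :: "real set" where "Q = \<rat> \<inter> {0..1}"
  have "\<forall>q\<in>Q. \<exists>S\<in>sets borel.
    (\<forall>r x. a < r \<longrightarrow> r < x \<longrightarrow> ennreal (1 + q * ((x - r) / (r - a))) < e x r \<longrightarrow> r \<in> S) \<and>
    (\<forall>r x. a < r \<longrightarrow> a \<le> x \<longrightarrow> x < r \<longrightarrow> ennreal (1 + q * ((x - r) / (r - a))) < e x r \<longrightarrow> r \<notin> S)"
    using exists_Borel_slope[OF e] by (simp add: Q_def)
  then obtain S where S: "\<And>q. q \<in> Q \<Longrightarrow> S q \<in> sets borel"
    and above: "\<And>q r x. \<lbrakk>q \<in> Q; a < r; r < x; ennreal (1 + q * ((x - r) / (r - a))) < e x r\<rbrakk> \<Longrightarrow> r \<in> S q"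
    and below: "\<And>q r x. \<lbrakk>q \<in> Q; a < r; a \<le> x; x < r; ennreal (1 + q * ((x - r) / (r - a))) < e x r\<rbrakk>
      \<Longrightarrow> r \<notin> S q"
    unfolding bchoice_iff by metis
  \<comment> \<open>A slope with \<open>r \<notin> S q\<close> contributes 0 instead of being
    dropped, which makes \<open>H\<close> a supremum of countably many Borel functions over a fixed
    index set.\<close>
  define H where "H r = (SUP q\<in>Q. q * indicator (S q) r)" for r
  \<comment> \<open>A positive value at \<open>a\<close> makes the bound infinite for
    \<open>x > a\<close>.\<close>
  define h where "h r = (if r \<le> a then 1 else H r)" for r
  have Q: "countable Q" "0 \<in> Q" "Q \<noteq> {}"
    by (auto simp: Q_def countable_rat)
  have term_le: "q * indicator (S q) r \<le> 1" if "q \<in> Q" for q r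
    using that by (auto simp: Q_def indicator_def)
  have bdd: "bdd_above ((\<lambda>q. q * indicator (S q) r) ` Q)" for r
    using term_le by (intro bdd_aboveI2)
  have H_ge: "q * indicator (S q) r \<le> H r" if "q \<in> Q" for q r
    unfolding H_def by (rule cSUP_upper[OF that bdd])
  have H_le: "H r \<le> 1" for r
    unfolding H_def using Q(3) term_le by (rule cSUP_least)
  have H_nonneg: "0 \<le> H r" for r
    using H_ge[OF Q(2), of r] by simp
  have "(\<lambda>r. q * indicator (S q) r :: real) \<in> borel_measurable borel" if "q \<in> Q" for q
    using S[OF that] by measurable
  then have [measurable]: "H \<in> borel_measurable borel"
    unfolding H_def[abs_def] using Q(1) bdd by (intro borel_measurable_cSUP) auto
  have "h \<in> borel_measurable borel"
    unfolding h_def[abs_def] by measurable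
  then have "h \<in> borel_measurable (restrict_space borel {a..})"
    by (rule measurable_restrict_space1)
  moreover have "0 \<le> h r \<and> h r \<le> 1" for r
    using H_le H_nonneg by (simp add: h_def)
  moreover have "e x r \<le> mean_e_bound a h x r" if "a \<le> x" "a \<le> r" for x r
  proof (cases "r = a")
    case True
    then show ?thesis
    proof (cases "x = a")
      case True
      then show ?thesis
        using one_sided_e_statistic_le_1[OF e, of a a] \<open>r = a\<close> by (simp add: mean_e_bound_at)
    next
      case False
      then show ?thesis
        using \<open>r = a\<close> that by (simp add: mean_e_bound_at h_def)
    qed
  next
    case False
    with that have "a < r"
      by simp
    define k where "k = (x - r) / (r - a)"
    have "e x r \<le> ennreal (1 + H r * k)"
    proof (rule ccontr)
      assume "\<not> e x r \<le> ennreal (1 + H r * k)"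
      then obtain c where c: "1 + H r * k < c" "0 < c" "ennreal c \<le> e x r"
        using ennreal_less_imp_ex_real[of "1 + H r * k" "e x r"] by (auto simp: not_le)
      \<comment> \<open>Every line that stays below \<open>c\<close> at \<open>x\<close> is exceeded
        there by \<open>e\<close>, so \<open>above\<close> or \<open>below\<close> applies to its
        slope.\<close>
      have less: "ennreal (1 + q * ((x - r) / (r - a))) < e x r" if "1 + q * k < c" for q
        using less_le_trans[OF ennreal_lessI[OF c(2) that] c(3)] by (simp only: k_def)
      consider "x = r" | "r < x" | "x < r"
        by linarith
      then show False
      proof cases
        case 1
        then have "ennreal c \<le> 1"
          using order_trans[OF c(3) one_sided_e_statistic_le_1[OF e \<open>a \<le> x\<close>]] by simp
        with c(1) 1 show False
          by (simp add: k_def)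
      next
        case 2
        then have "0 < k"
          using \<open>a < r\<close> by (simp add: k_def)
        have "ennreal c \<le> ennreal ((x - a) / (r - a))"
          using c(3) one_sided_e_statistic_le_Markov[OF e \<open>a < r\<close> 2] by (rule order_trans)
        moreover have "(x - a) / (r - a) = 1 + k"
          using \<open>a < r\<close> by (simp add: k_def field_simps)
        ultimately have "c \<le> 1 + k"
          using ennreal_le_iff[of "1 + k" c] \<open>0 < k\<close> by (simp only:)
        with c(1) have "H r * k < 1 * k"
          by linarith
        then have "H r < 1"
          using \<open>0 < k\<close> by (simp only: mult_less_cancel_right_pos)
        moreover have "H r < (c - 1) / k"
          using c(1) \<open>0 < k\<close> by (simp add: field_simps)
        \<comment> \<open>Markov's bound gave \<open>H r < 1\<close>, so there is room for a
          rational slope \<open>q\<close> above \<open>H r\<close> inside \<open>Q\<close>. Its line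
          is still exceeded to the right of \<open>r\<close>, which forces
          \<open>q \<le> H r\<close>.\<close>
        ultimately have "H r < min 1 ((c - 1) / k)"
          by simp
        then obtain q where q: "q \<in> \<rat>" "H r < q" "q < min 1 ((c - 1) / k)"
          using Rats_dense_in_real by blast
        then have "q \<in> Q"
          using H_nonneg[of r] by (simp add: Q_def)
        have "1 + q * k < c"
          using q(3) \<open>0 < k\<close> by (simp add: field_simps)
        from above[OF \<open>q \<in> Q\<close> \<open>a < r\<close> 2 less[OF this]] have "q \<le> H r"
          using H_ge[OF \<open>q \<in> Q\<close>, of r] by simp
        then show False
          using q(2) by simp
      next
        case 3
        then have "k < 0"
          using \<open>a < r\<close> by (simp add: k_def divide_neg_pos)
        have "ennreal c \<le> 1"
          using order_trans[OF c(3) one_sided_e_statistic_le_1[OF e \<open>a \<le> x\<close>]] 3 by simp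
        then have "c \<le> 1"
          by simp
        have "(c - 1) / k < H r"
          using c(1) \<open>k < 0\<close> by (simp add: field_simps)
        then obtain q where q: "q \<in> \<rat>" "(c - 1) / k < q" "q < H r"
          using Rats_dense_in_real by blast
        have "0 \<le> (c - 1) / k"
          using \<open>c \<le> 1\<close> \<open>k < 0\<close> by (simp add: zero_le_divide_iff)
        \<comment> \<open>To the left of \<open>r\<close> steeper lines are lower. Each slope
          \<open>q'\<close> above \<open>q\<close> thus fails at \<open>x\<close>, giving
          \<open>r \<notin> S q'\<close> and a zero term; hence \<open>q\<close> bounds the
          supremum, against \<open>q < H r\<close>.\<close>
        have "q' * indicator (S q') r \<le> q" if "q' \<in> Q" for q'
        proof (cases "q' \<le> q")
          case True
          then show ?thesis
            using that by (auto simp: Q_def indicator_def)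
        next
          case False
          then have "(c - 1) / k < q'"
            using q(2) by simp
          then have "1 + q' * k < c"
            using \<open>k < 0\<close> by (simp add: field_simps)
          from below[OF that \<open>a < r\<close> \<open>a \<le> x\<close> 3 less[OF this]] show ?thesis
            using q(2) \<open>0 \<le> (c - 1) / k\<close> by simp
        qed
        then have "H r \<le> q"
          unfolding H_def by (intro cSUP_least Q(3))
        then show False
          using q(3) by simp
      qed
    qed
    then show ?thesis
      using \<open>a < r\<close> by (simp add: mean_e_bound_above h_def k_def)
  qed
  ultimately show ?thesis
    by blast
qed



section \<open>Validity and monotonicity of the upper bound\<close>

lemma (in real_distribution) measure_UNIV:
  "measure M UNIV = 1" "emeasure M UNIV = 1"
  using prob_space emeasure_space_1 by simp_all

lemma mean_ge_of_supported:
  assumes "F \<in> dists_supported_from a"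
  shows "a \<le> mean F"
proof -
  interpret real_distribution F
    using assms by (simp add: dists_supported_from_def finite_mean_dists_def)
  have "(LINT x|F. a) \<le> (LINT x|F. x)"
    using assms by (intro integral_mono_AE) (auto simp: dists_supported_from_def finite_mean_dists_def)
  then show ?thesis
    by (simp add: mean_def measure_UNIV)
qed

text \<open>Point masses attain every mean in \<open>{a..}\<close>, so the backtest condition ranges
  over all \<open>r \<ge> a\<close>.\<close>

lemma mean_image_dists_supported: "mean ` dists_supported_from a = {a..}"
proof (intro equalityI subsetI)
  fix r assume "r \<in> {a..}"
  then have "two_point_dist 1 r r \<in> dists_supported_from a" "mean (two_point_dist 1 r r) = r"
    by (simp_all add: two_point_dist_supported mean_two_point_dist)
  then show "r \<in> mean ` dists_supported_from a"
    by force
qed (auto simp: mean_ge_of_supported)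

lemma nn_integral_affine:
  assumes F: "F \<in> dists_supported_from a" and nonneg: "\<And>x. a \<le> x \<Longrightarrow> 0 \<le> b + c * x"
  shows "(\<integral>\<^sup>+x. ennreal (b + c * x) \<partial>F) = ennreal (b + c * mean F)"
proof -
  interpret real_distribution F
    using F by (simp add: dists_supported_from_def finite_mean_dists_def)
  have int: "integrable F (\<lambda>x. x)" and ae: "AE x in F. a \<le> x"
    using F by (simp_all add: dists_supported_from_def finite_mean_dists_def)
  have "(\<integral>\<^sup>+x. ennreal (b + c * x) \<partial>F) = ennreal (LINT x|F. b + c * x)"
    using int ae nonneg by (intro nn_integral_eq_integral) (auto intro: AE_mp)
  also have "(LINT x|F. b + c * x) = b + c * mean F"
    using int by (simp add: mean_def measure_UNIV)
  finally show ?thesis .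
qed

text \<open>Intercept at \<open>a\<close> plus slope times \<open>x - a\<close>. For
  \<open>0 \<le> h \<le> 1\<close> and \<open>x \<ge> a\<close> both summands are nonnegative, so
  truncation by \<open>ennreal\<close> is harmless.\<close>

lemma affine_bound_eq:
  fixes a h r x :: real
  assumes "a < r"
  shows "1 + h * ((x - r) / (r - a)) = 1 - h + (x - a) * (h / (r - a))"
proof -
  define k where "k = (x - a) / (r - a)"
  have "(x - r) / (r - a) = k - 1"
    using assms by (simp add: k_def field_simps)
  moreover have "(x - a) * (h / (r - a)) = h * k"
    by (simp add: k_def)
  ultimately show ?thesis
    by (simp only: right_diff_distrib)
qed

lemma mean_e_bound_eq:
  assumes "a < r"
  shows "mean_e_bound a h x r = ennreal (1 - h r + (x - a) * (h r / (r - a)))"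
  using assms by (simp only: mean_e_bound_above affine_bound_eq)

lemma nn_integral_mean_e_bound:
  assumes F: "F \<in> dists_supported_from a" and "a < r" "0 \<le> h r" "h r \<le> 1"
  shows "(\<integral>\<^sup>+x\<in>{a..}. mean_e_bound a h x r \<partial>F) = ennreal (1 + h r * ((mean F - r) / (r - a)))"
proof -
  have ae: "AE x in F. a \<le> x"
    using F by (simp add: dists_supported_from_def)
  define c where "c = h r / (r - a)"
  have affine: "1 - h r + (x - a) * c = (1 - h r - a * c) + c * x" for x
    by (simp add: algebra_simps)
  have "0 \<le> c"
    using assms by (simp add: c_def)
  have "(\<integral>\<^sup>+x\<in>{a..}. mean_e_bound a h x r \<partial>F) = (\<integral>\<^sup>+x. ennreal ((1 - h r - a * c) + c * x) \<partial>F)"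
    using ae \<open>a < r\<close>
    by (intro nn_integral_cong_AE) (auto simp only: mean_e_bound_eq c_def[symmetric] affine indicator_simps
        atLeast_iff mult_1_right elim!: eventually_mono)
  also have "\<dots> = ennreal ((1 - h r - a * c) + c * mean F)"
    using assms \<open>0 \<le> c\<close> by (intro nn_integral_affine[OF F]) (simp add: affine[symmetric])
  finally show ?thesis
    by (simp only: affine_bound_eq[OF \<open>a < r\<close>] c_def[symmetric] affine)
qed

text \<open>Mean \<open>a\<close> forces \<open>x = a\<close> almost everywhere, and there the bound
  is 1 even if it is infinite for all larger \<open>x\<close>.\<close>

lemma nn_integral_mean_e_bound_at:
  assumes F: "F \<in> dists_supported_from a" and "mean F = a"
  shows "(\<integral>\<^sup>+x\<in>{a..}. mean_e_bound a h x a \<partial>F) = 1"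
proof -
  interpret real_distribution F
    using F by (simp add: dists_supported_from_def finite_mean_dists_def)
  have int: "integrable F (\<lambda>x. x)" and ae: "AE x in F. a \<le> x"
    using F by (simp_all add: dists_supported_from_def finite_mean_dists_def)
  have "(LINT x|F. x - a) = 0"
    using int \<open>mean F = a\<close> by (simp add: mean_def measure_UNIV)
  then have "AE x in F. x - a = 0"
    using int ae by (subst (asm) integral_nonneg_eq_0_iff_AE) auto
  then have "(\<integral>\<^sup>+x\<in>{a..}. mean_e_bound a h x a \<partial>F) = (\<integral>\<^sup>+x. 1 \<partial>F)"
    by (intro nn_integral_cong_AE) (auto simp: mean_e_bound_at)
  then show ?thesis
    by (simp add: measure_UNIV)
qed

text \<open>On the line \<open>r = a\<close> the bound takes only the values 1 and \<infinity>; off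
  it, the real formula is Borel.\<close>

lemma mean_e_bound_measurable:
  assumes h: "h \<in> borel_measurable (restrict_space borel {a..})" and "0 \<le> h a"
  shows "(\<lambda>(x, r). mean_e_bound a h x r) \<in> borel_measurable (restrict_space borel ({a..} \<times> {a..}))"
proof -
  let ?M = "restrict_space borel ({a..} \<times> {a..}) :: (real \<times> real) measure"
  have [measurable]: "fst \<in> borel_measurable ?M" "snd \<in> borel_measurable ?M"
    by (auto intro!: measurable_restrict_space1 borel_measurable_continuous_onI continuous_intros)
  have "snd \<in> measurable ?M (restrict_space borel {a..})"
    by (intro measurable_restrict_space2) (auto simp: space_restrict_space)
  from measurable_compose[OF this h] have [measurable]: "(\<lambda>p. h (snd p)) \<in> borel_measurable ?M" .
  have "(\<lambda>p. if snd p = a then if fst p = a \<or> h a = 0 then 1 else \<infinity>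
      else ennreal (1 + h (snd p) * ((fst p - snd p) / (snd p - a)))) \<in> borel_measurable ?M"
    by measurable
  then show ?thesis
    by (rule measurable_cong[THEN iffD1, rotated])
      (use \<open>0 \<le> h a\<close> in \<open>auto simp: space_restrict_space mean_e_bound_at mean_e_bound_above\<close>)
qed

section \<open>One-sided and backtest properties of the bound\<close>

lemma one_sided_e_statistic_mean_e_bound:
  assumes h: "h \<in> borel_measurable (restrict_space borel {a..})" "\<And>r. a \<le> r \<Longrightarrow> 0 \<le> h r \<and> h r \<le> 1"
  shows "one_sided_e_statistic {a..} {a..} (dists_supported_from a) mean (mean_e_bound a h)"
proof -
  have "(\<integral>\<^sup>+x\<in>{a..}. mean_e_bound a h x r \<partial>F) \<le> 1"
    if F: "F \<in> dists_supported_from a" and r: "a \<le> r" "mean F \<le> r" for F r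
  proof (cases "r = a")
    case True
    then have "mean F = a"
      using mean_ge_of_supported[OF F] r by simp
    then show ?thesis
      using nn_integral_mean_e_bound_at[OF F] True by simp
  next
    case False
    with r have "a < r"
      by simp
    then have "h r * ((mean F - r) / (r - a)) \<le> 0"
      using h(2)[OF r(1)] r(2) by (intro mult_nonneg_nonpos) (auto simp: divide_nonpos_pos)
    then have "ennreal (1 + h r * ((mean F - r) / (r - a))) \<le> ennreal 1"
      by (intro ennreal_leI) simp
    then show ?thesis
      using nn_integral_mean_e_bound[OF F \<open>a < r\<close>] h(2)[OF r(1)] by simp
  qed
  then show ?thesis
    using mean_e_bound_measurable[OF h(1)] h(2) by (simp add: one_sided_e_statistic_def)
qed

lemma backtest_e_statistic_mean_e_bound:
  assumes h: "h \<in> borel_measurable (restrict_space borel {a..})" "\<And>r. a \<le> r \<Longrightarrow> 0 < h r \<and> h r \<le> 1"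
  shows "backtest_e_statistic {a..} {a..} (dists_supported_from a) mean (mean_e_bound a h)"
proof -
  have "1 < (\<integral>\<^sup>+x\<in>{a..}. mean_e_bound a h x r \<partial>F)"
    if F: "F \<in> dists_supported_from a" and r: "a \<le> r" "r < mean F" for F r
  proof (cases "r = a")
    case True
    have ae: "AE x in F. a \<le> x"
      using F by (simp add: dists_supported_from_def)
    \<comment> \<open>At \<open>r = a\<close> the bound dominates \<open>1 + (x - a)\<close>, whose
      expectation \<open>1 + mean F - a\<close> exceeds 1.\<close>
    have "(1::ennreal) = ennreal 1"
      by simp
    also have "\<dots> < ennreal ((1 - a) + 1 * mean F)"
      using r by (intro ennreal_lessI) auto
    also have "\<dots> = (\<integral>\<^sup>+x. ennreal ((1 - a) + 1 * x) \<partial>F)"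
      by (rule nn_integral_affine[OF F, symmetric]) simp
    also have "\<dots> \<le> (\<integral>\<^sup>+x\<in>{a..}. mean_e_bound a h x r \<partial>F)"
    proof (rule nn_integral_mono_AE)
      have "ennreal ((1 - a) + 1 * x) \<le> mean_e_bound a h x r" if "a \<le> x" for x
        using that h(2)[of a] True by (cases "x = a") (auto simp: mean_e_bound_at)
      then show "AE x in F. ennreal ((1 - a) + 1 * x) \<le> mean_e_bound a h x r * indicator {a..} x"
        using ae by (auto elim!: eventually_mono)
    qed
    finally show ?thesis .
  next
    case False
    with r have "a < r"
      by simp
    then have "0 < h r * ((mean F - r) / (r - a))"
      using h(2)[OF r(1)] r(2) by simp
    then have "ennreal 1 < ennreal (1 + h r * ((mean F - r) / (r - a)))"
      by (intro ennreal_lessI) auto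
    then show ?thesis
      using nn_integral_mean_e_bound[OF F \<open>a < r\<close>] h(2)[OF r(1)] by (simp add: less_imp_le)
  qed
  then show ?thesis
    using one_sided_e_statistic_mean_e_bound[OF h(1)] h(2)
    by (simp add: backtest_e_statistic_def mean_image_dists_supported less_imp_le)
qed

text \<open>Where \<open>h r = 0\<close> the bound is constantly 1, so it cannot detect the point
  mass at \<open>r + 1\<close>, whose mean exceeds \<open>r\<close>.\<close>

lemma backtest_e_statistic_mean_e_bound_imp_pos:
  assumes "backtest_e_statistic {a..} {a..} (dists_supported_from a) mean (mean_e_bound a h)"
    and "a \<le> r" "0 \<le> h r"
  shows "0 < h r"
proof (rule ccontr)
  assume "\<not> 0 < h r"
  then have "h r = 0"
    using \<open>0 \<le> h r\<close> by simp
  define F where "F = two_point_dist 1 (r + 1) (r + 1)"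
  have F: "F \<in> dists_supported_from a" "mean F = r + 1"
    using \<open>a \<le> r\<close> by (simp_all add: F_def two_point_dist_supported mean_two_point_dist)
  interpret real_distribution F
    using F by (simp add: dists_supported_from_def finite_mean_dists_def)
  have eq_1: "mean_e_bound a h x r = 1" for x
    using \<open>h r = 0\<close> \<open>a \<le> r\<close> by (cases "r = a") (auto simp: mean_e_bound_at mean_e_bound_above)
  have "1 < (\<integral>\<^sup>+x\<in>{a..}. mean_e_bound a h x r \<partial>F)"
    using assms(1,2) F by (simp add: backtest_e_statistic_def mean_image_dists_supported)
  also have "\<dots> \<le> (\<integral>\<^sup>+x. 1 \<partial>F)"
    by (intro nn_integral_mono) (simp add: eq_1 indicator_def)
  finally show False
    by (simp add: measure_UNIV)
qed

section \<open>Monotonicity of the bound in the parameter\<close>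

lemma ext_div_pos: "0 < v \<Longrightarrow> ext_div u v = ereal (u / v)"
  by (simp add: ext_div_def)

text \<open>For \<open>r > a\<close> the quotient is the reciprocal of the slope of the bound. At
  \<open>r = a\<close> it is 0, because \<open>h a > 0\<close>, and hence minimal.\<close>

lemma mono_on_ext_div_iff:
  assumes pos: "\<And>r. a \<le> r \<Longrightarrow> 0 < h r"
  shows "mono_on {a..} (\<lambda>r. ext_div (r - a) (h r)) \<longleftrightarrow>
    (\<forall>r s. a < r \<longrightarrow> r \<le> s \<longrightarrow> h s / (s - a) \<le> h r / (r - a))"
proof -
  have swap: "(r - a) / h r \<le> (s - a) / h s \<longleftrightarrow> h s / (s - a) \<le> h r / (r - a)"
    if "a < r" "r \<le> s" for r s
    using that pos[of r] pos[of s] by (simp add: divide_simps mult.commute)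
  show ?thesis
  proof (intro iffI allI impI)
    fix r s assume "mono_on {a..} (\<lambda>r. ext_div (r - a) (h r))" "a < r" "r \<le> s"
    then have "ext_div (r - a) (h r) \<le> ext_div (s - a) (h s)"
      by (intro mono_onD[of "{a..}" "\<lambda>r. ext_div (r - a) (h r)"]) auto
    then show "h s / (s - a) \<le> h r / (r - a)"
      using \<open>a < r\<close> \<open>r \<le> s\<close> pos[of r] pos[of s] swap[of r s] by (simp only: ext_div_pos ereal_less_eq)
  next
    assume anti: "\<forall>r s. a < r \<longrightarrow> r \<le> s \<longrightarrow> h s / (s - a) \<le> h r / (r - a)"
    show "mono_on {a..} (\<lambda>r. ext_div (r - a) (h r))"
    proof (rule mono_onI)
      fix r s assume rs: "r \<in> {a..}" "s \<in> {a..}" "r \<le> s"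
      have "(r - a) / h r \<le> (s - a) / h s"
      proof (cases "r = a")
        case True
        then show ?thesis
          using rs pos[of s] by simp
      next
        case False
        then show ?thesis
          using rs anti swap[of r s] by simp
      qed
      then show "ext_div (r - a) (h r) \<le> ext_div (s - a) (h s)"
        using rs pos[of r] pos[of s] by (simp add: ext_div_pos)
    qed
  qed
qed

text \<open>For \<open>r > a\<close> both the intercept \<open>1 - h r\<close> and the slope
  \<open>h r / (r - a)\<close> decrease in \<open>r\<close>. At \<open>r = a\<close> the bound is
  \<infinity> for \<open>x > a\<close>, and at \<open>x = a\<close> it is 1, which no later
  intercept exceeds.\<close>

lemma antimono_on_mean_e_bound:
  assumes h: "\<And>r. a \<le> r \<Longrightarrow> 0 < h r \<and> h r \<le> 1"
    and mono: "mono_on {a<..} h" "mono_on {a..} (\<lambda>r. ext_div (r - a) (h r))" and "a \<le> x"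
  shows "antimono_on {a..} (\<lambda>r. mean_e_bound a h x r)"
proof (rule monotone_onI)
  fix r s assume rs: "r \<in> {a..}" "s \<in> {a..}" "r \<le> s"
  consider "s = r" | "r = a" "a < s" | "a < r" "a < s"
    using rs by fastforce
  then show "mean_e_bound a h x s \<le> mean_e_bound a h x r"
  proof cases
    case 2
    show ?thesis
    proof (cases "x = a")
      case True
      have "ennreal (1 - h s) \<le> ennreal 1"
        using h[of s] 2 by (intro ennreal_leI) simp
      with 2 True show ?thesis
        by (simp add: mean_e_bound_at mean_e_bound_eq)
    next
      case False
      then show ?thesis
        using 2 h[of a] \<open>a \<le> x\<close> by (simp add: mean_e_bound_at)
    qed
  next
    case 3
    have "h s / (s - a) \<le> h r / (r - a)"
      using mono(2) 3 rs(3) h by (subst (asm) mono_on_ext_div_iff) auto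
    moreover have "h r \<le> h s"
      using mono_onD[OF mono(1), of r s] 3 rs(3) by simp
    ultimately have "1 - h s + (x - a) * (h s / (s - a)) \<le> 1 - h r + (x - a) * (h r / (r - a))"
      using \<open>a \<le> x\<close> by (intro add_mono mult_left_mono) auto
    then show ?thesis
      using 3 by (simp add: mean_e_bound_eq ennreal_leI)
  qed simp
qed

text \<open>The point \<open>x = a\<close> isolates the intercept and so the monotonicity of
  \<open>h\<close>; large \<open>x\<close> isolates the slope.\<close>

lemma mono_of_antimono_on_mean_e_bound:
  assumes h: "\<And>r. a \<le> r \<Longrightarrow> 0 < h r \<and> h r \<le> 1"
    and anti: "\<And>x. a \<le> x \<Longrightarrow> antimono_on {a..} (\<lambda>r. mean_e_bound a h x r)"
  shows "mono_on {a<..} h" "mono_on {a..} (\<lambda>r. ext_div (r - a) (h r))"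
proof -
  have le: "1 - h s + (x - a) * (h s / (s - a)) \<le> 1 - h r + (x - a) * (h r / (r - a))"
    if "a < r" "r \<le> s" "a \<le> x" for r s x
  proof -
    have "mean_e_bound a h x s \<le> mean_e_bound a h x r"
      using monotone_onD[OF anti[OF \<open>a \<le> x\<close>], of r s] that by simp
    moreover have "0 \<le> 1 - h r + (x - a) * (h r / (r - a))"
      using h[of r] that by simp
    ultimately show ?thesis
      using that by (simp add: mean_e_bound_eq ennreal_le_iff)
  qed
  show "mono_on {a<..} h"
    using le[of _ _ a] by (intro mono_onI) simp
  have "h s / (s - a) \<le> h r / (r - a)" if "a < r" "r \<le> s" for r s
  proof (rule ccontr)
    \<comment> \<open>If the slope grew by \<open>d > 0\<close>, the inequality at
      \<open>x = a + 1 / d\<close> would give \<open>1 \<le> h s - h r\<close>, impossible for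
      values of \<open>h\<close> in \<open>(0, 1]\<close>.\<close>
    define d where "d = h s / (s - a) - h r / (r - a)"
    assume "\<not> h s / (s - a) \<le> h r / (r - a)"
    then have "0 < d"
      by (simp add: d_def)
    have "(1 / d) * d \<le> h s - h r"
      using le[OF that, of "a + 1 / d"] \<open>0 < d\<close> unfolding d_def right_diff_distrib by simp
    then show False
      using \<open>0 < d\<close> h[of r] h[of s] that by simp
  qed
  then show "mono_on {a..} (\<lambda>r. ext_div (r - a) (h r))"
    using h by (subst mono_on_ext_div_iff) auto
qed

text \<open>Supplies the measurability of \<open>h\<close> in the monotone equivalence, where it
  follows from monotonicity; adding the single point \<open>a\<close> preserves it.\<close>

lemma mono_on_greaterThan_measurable:
  fixes h :: "real \<Rightarrow> real"
  assumes "mono_on {a<..} h"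
  shows "h \<in> borel_measurable (restrict_space borel {a..})"
proof -
  have "(\<lambda>r. indicator {a<..} r *\<^sub>R h r) \<in> borel_measurable borel"
    using borel_measurable_mono_on_fnc[OF assms] by (subst (asm) borel_measurable_restrict_space_iff) auto
  then have [measurable]: "(\<lambda>r. indicator {a<..} r * h r) \<in> borel_measurable borel"
    by simp
  have "(\<lambda>r. if r = a then h a else indicator {a<..} r * h r) \<in> borel_measurable borel"
    by measurable
  then have "(\<lambda>r. if r = a then h a else indicator {a<..} r * h r)
      \<in> borel_measurable (restrict_space borel {a..})"
    by (rule measurable_restrict_space1)
  then show ?thesis
    by (rule measurable_cong[THEN iffD1, rotated]) (auto simp: space_restrict_space)
qed

text \<open>Positivity is explicit in the last equivalence: for \<open>h = 0\<close> the quotient is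
  1 at \<open>a\<close> and \<infinity> beyond, so both functions are increasing, yet the bound is
  constantly 1 and not a backtest e-statistic. Monotonicity of \<open>h\<close> is stated on
  \<open>{a<..}\<close> because, at \<open>r = a\<close>, the bound sees only whether
  \<open>h a > 0\<close>.\<close>

theorem proposition5:
  fixes a :: real
  shows
    "(\<forall>e. one_sided_e_statistic {a..} {a..} (dists_supported_from a) mean e \<longrightarrow>
        (\<exists>h. h \<in> borel_measurable (restrict_space borel {a..}) \<and>
             (\<forall>r\<ge>a. 0 \<le> h r \<and> h r \<le> 1) \<and>
             (\<forall>x\<ge>a. \<forall>r\<ge>a. e x r \<le> mean_e_bound a h x r))) \<and>
     (\<forall>h. h \<in> borel_measurable (restrict_space borel {a..}) \<and> (\<forall>r\<ge>a. 0 \<le> h r \<and> h r \<le> 1) \<longrightarrow>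
        one_sided_e_statistic {a..} {a..} (dists_supported_from a) mean (mean_e_bound a h) \<and>
        (backtest_e_statistic {a..} {a..} (dists_supported_from a) mean (mean_e_bound a h)
           \<longleftrightarrow> (\<forall>r\<ge>a. 0 < h r))) \<and>
     (\<forall>h. (\<forall>r\<ge>a. 0 \<le> h r \<and> h r \<le> 1) \<longrightarrow>
        ((\<forall>r\<ge>a. 0 < h r) \<and> mono_on {a<..} h \<and> mono_on {a..} (\<lambda>r. ext_div (r - a) (h r))
           \<longleftrightarrow> monotone_backtest_e_statistic {a..} {a..} (dists_supported_from a) mean
                 (mean_e_bound a h)))"
proof (intro conjI allI impI)
  fix e assume "one_sided_e_statistic {a..} {a..} (dists_supported_from a) mean e"
  then show "\<exists>h. h \<in> borel_measurable (restrict_space borel {a..}) \<and>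
      (\<forall>r\<ge>a. 0 \<le> h r \<and> h r \<le> 1) \<and> (\<forall>x\<ge>a. \<forall>r\<ge>a. e x r \<le> mean_e_bound a h x r)"
    by (rule one_sided_e_statistic_le_mean_e_bound)
next
  fix h :: "real \<Rightarrow> real"
  assume h: "h \<in> borel_measurable (restrict_space borel {a..}) \<and> (\<forall>r\<ge>a. 0 \<le> h r \<and> h r \<le> 1)"
  then show "one_sided_e_statistic {a..} {a..} (dists_supported_from a) mean (mean_e_bound a h)"
    by (simp add: one_sided_e_statistic_mean_e_bound)
  show "backtest_e_statistic {a..} {a..} (dists_supported_from a) mean (mean_e_bound a h)
      \<longleftrightarrow> (\<forall>r\<ge>a. 0 < h r)"
    using h backtest_e_statistic_mean_e_bound[of h a] backtest_e_statistic_mean_e_bound_imp_pos[of a h]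
    by blast
next
  fix h :: "real \<Rightarrow> real"
  assume h: "\<forall>r\<ge>a. 0 \<le> h r \<and> h r \<le> 1"
  show "(\<forall>r\<ge>a. 0 < h r) \<and> mono_on {a<..} h \<and> mono_on {a..} (\<lambda>r. ext_div (r - a) (h r))
      \<longleftrightarrow> monotone_backtest_e_statistic {a..} {a..} (dists_supported_from a) mean (mean_e_bound a h)"
    (is "?L \<longleftrightarrow> ?R")
  proof
    assume ?L
    with h have "\<And>r. a \<le> r \<Longrightarrow> 0 < h r \<and> h r \<le> 1"
      by blast
    with \<open>?L\<close> show ?R
      unfolding monotone_backtest_e_statistic_def
      by (auto intro!: backtest_e_statistic_mean_e_bound mono_on_greaterThan_measurable
          antimono_on_mean_e_bound)
  next
    assume ?R
    then have bt: "backtest_e_statistic {a..} {a..} (dists_supported_from a) mean (mean_e_bound a h)"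
      and anti: "\<And>x. a \<le> x \<Longrightarrow> antimono_on {a..} (\<lambda>r. mean_e_bound a h x r)"
      by (simp_all add: monotone_backtest_e_statistic_def)
    have pos: "\<And>r. a \<le> r \<Longrightarrow> 0 < h r \<and> h r \<le> 1"
      using h backtest_e_statistic_mean_e_bound_imp_pos[OF bt] by blast
    show ?L
      using pos mono_of_antimono_on_mean_e_bound[OF pos anti] by blast
  qed
qed

end
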